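(* There exists a sequence $(G_n)_{n\in\mathbb N}$ of directed acyclic graphs with uniformly bounded degrees (i.e. $\sup_n \max_{v\in V(G_n)} \deg(v;G_n)<\infty$) which is an $(n^{\delta})$-extender sequence, with $\delta\approx 0.019$; that is, $\lim_{n\to\infty}|V(G_n)|=\infty$ and there exist $\varepsilon>0$ and $C>0$ such that for every $n\in\mathbb N$ the graph $G_n$ is an $(\varepsilon, C\cdot |V(G_n)|^{\delta})$-extender.
   Context: A graph is a pair $G=(V,E)$ with $V$ a non-empty finite set and $E\subset V\times V$ disjoint from the diagonal; elements of $E$ are directed edges. The degree $\deg(v;G)$ is the in-degree plus the out-degree of $v$. A directed simple path of length $D\ge 0$ is a tuple $(x_0,\ldots,x_D)$ of pairwise distinct vertices with $(x_i,x_{i+1})\in E$ for all $i<D$. A directed acyclic graph (dag) is a graph with no directed cycles. For a proper subset $S\subsetneq V(G)$, $\operatorname{codepth}(S;G)\in\mathbb N$ is the maximal $D$ such that there exists a directed simple path $(x_0,\ldots,x_D)$ in $G$ disjoint from $S$. For $\varepsilon,\rho>0$, a dag $G$ is an $(\varepsilon,\rho)$-extender if for every $S\subsetneq V(G)$ with $|S|\le \varepsilon|V(G)|$ we have $\operatorname{codepth}(S;G)\ge\rho$. For a sequence $(\rho_n)$ of positive reals with $\rho_n\to\infty$, a sequence $(G_n)$ of dags with uniformly bounded in-degrees is a $(\rho_n)$-extender sequence if $|V(G_n)|\to\infty$ and there exist $\varepsilon>0$, $C>0$ such that for all $n$, $G_n$ is an $(\varepsilon, C\rho_{|V(G_n)|})$-extender.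 *)

theory Defs
  imports "HOL-Analysis.Analysis" "Graph_Theory.Graph_Theory"
begin

definition dag :: "'a pair_pre_digraph \<Rightarrow> bool" where
  "dag G \<longleftrightarrow> pair_digraph G \<and> pverts G \<noteq> {} \<and> \<not> (\<exists>p. pre_digraph.cycle (with_proj G) p)"

definition degree_at :: "'a pair_pre_digraph \<Rightarrow> 'a \<Rightarrow> nat" where
  "degree_at G v = in_degree (with_proj G) v + out_degree (with_proj G) v"

definition bounded_in_degrees :: "(nat \<Rightarrow> 'a pair_pre_digraph) \<Rightarrow> bool" where
  "bounded_in_degrees G \<longleftrightarrow> (\<exists>B. \<forall>n. \<forall>v\<in>pverts (G n). in_degree (with_proj (G n)) v \<le> B)"

definition bounded_degrees :: "(nat \<Rightarrow> 'a pair_pre_digraph) \<Rightarrow> bool" where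
  "bounded_degrees G \<longleftrightarrow> (\<exists>B. \<forall>n. \<forall>v\<in>pverts (G n). degree_at (G n) v \<le> B)"

text \<open>A \<open>vpath\<close> is a non-empty list of distinct vertices, consecutive ones being joined by an
  arc; \<open>vwalk_length\<close> counts its arcs. The maximum is only meaningful for finite \<open>G\<close> and
  \<open>S \<subset> pverts G\<close>, when one-vertex paths avoiding \<open>S\<close> exist.\<close>

definition codepth :: "'a set \<Rightarrow> 'a pair_pre_digraph \<Rightarrow> nat" where
  "codepth S G = Max {vwalk_length p | p. vpath p (with_proj G) \<and> set p \<inter> S = {}}"

definition extender :: "real \<Rightarrow> real \<Rightarrow> 'a pair_pre_digraph \<Rightarrow> bool" where
  "extender \<epsilon> \<rho> G \<longleftrightarrow> dag G \<and>
     (\<forall>S. S \<subset> pverts G \<and> real (card S) \<le> \<epsilon> * real (card (pverts G)) \<longrightarrow>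
        real (codepth S G) \<ge> \<rho>)"

text \<open>Only the values \<open>\<rho> n\<close> with \<open>n \<ge> 1\<close> matter, since graphs have at least one vertex;
  positivity is not required at \<open>0\<close>, as \<open>0 powr \<delta> = 0\<close>.\<close>

definition extender_sequence :: "(nat \<Rightarrow> real) \<Rightarrow> (nat \<Rightarrow> 'a pair_pre_digraph) \<Rightarrow> bool" where
  "extender_sequence \<rho> G \<longleftrightarrow>
     (\<forall>n\<ge>1. \<rho> n > 0) \<and> filterlim \<rho> at_top sequentially \<and>
     (\<forall>n. dag (G n)) \<and> bounded_in_degrees G \<and>
     filterlim (\<lambda>n. card (pverts (G n))) at_top sequentially \<and>
     (\<exists>\<epsilon>>0. \<exists>C>0. \<forall>n. extender \<epsilon> (C * \<rho> (card (pverts (G n)))) (G n))"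

lemma le_codepth_iff:
  assumes "finite (pverts G)" "S \<subset> pverts G"
  shows "D \<le> codepth S G \<longleftrightarrow>
    (\<exists>p. vpath p (with_proj G) \<and> set p \<inter> S = {} \<and> D \<le> vwalk_length p)"
proof -
  let ?A = "{vwalk_length p | p. vpath p (with_proj G) \<and> set p \<inter> S = {}}"
  have "vwalk_length p \<le> card (pverts G)" if "vpath p (with_proj G)" for p
    using that card_mono[OF assms(1), of "set p"] distinct_card[of p]
    by (auto simp: vpath_def vwalk_def)
  then have fin: "finite ?A"
    by (intro finite_subset[of ?A "{..card (pverts G)}"]) auto
  obtain v where "v \<in> pverts G" "v \<notin> S"
    using assms(2) by blast
  then have "vpath [v] (with_proj G)" "set [v] \<inter> S = {}"
    by (auto simp: vpath_def vwalk_def)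
  then have "?A \<noteq> {}"
    by blast
  with fin show ?thesis
    unfolding codepth_def by (subst Max_ge_iff) auto
qed

end

(* The vertices are triples (t, a, b) with t a bit string of length 2K and a < K <= b < 2K. For each
   position j and each prefix p of length j, a bounded degree disperser joins the vertices that
   have prefix p, bit j equal to 0 and j in {a, b} to those with bit j equal to 1. All arcs
   increase t lexicographically.

   Delete a small set S and label each other vertex by the length of the longest path ending
   there, with maximum L. As labels increase along arcs, each disperser forces a threshold
   depending on (j, p) such that bit j of most of its vertices says whether the label reaches the
   threshold. A vertex has the same label for a and for b, and flipping bit b does not affect the
   data at a; hence, with few exceptions, bit a says whether the threshold at b exceeds the one at
   a. For a suitable fixed b, one of the L + 2 possible values of the threshold at b therefore
   predicts at least 3/4 of the first K bits of t online, for half of all t. A single value does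
   so only for an exponentially small proportion of t, so L is exponential in K. *)
theory Submission
  imports Defs "HOL-Real_Asymp.Real_Asymp"
begin

section \<open>Dispersers\<close>

text \<open>A random map assigning \<open>c\<close> out-neighbours to each point of \<open>X\<close> avoids all pairs of dense sets
  with positive probability; removing the points of \<open>Y\<close> of large in-degree bounds the degrees
  and costs less than half of a dense subset of \<open>Y\<close>.\<close>

lemma exists_map_hitting_dense_sets:
  obtains c :: nat where
    "\<And>X Y. finite X \<Longrightarrow> finite Y \<Longrightarrow> card X = card Y \<Longrightarrow>
      \<exists>f \<in> (X \<times> {..<c}) \<rightarrow> Y. \<forall>A B. A \<subseteq> X \<longrightarrow> B \<subseteq> Y \<longrightarrow>
        card X < 48 * card A \<longrightarrow> card Y < 96 * card B \<longrightarrow> f ` (A \<times> {..<c}) \<inter> B \<noteq> {}"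
proof -
  \<comment> \<open>\<open>P\<close> has at most \<open>4 ^ N\<close> pairs, and each is missed by
    at most a fraction \<open>((95/96) ^ m) ^ N\<close> of the maps, so
    \<open>4 * (95/96) ^ m < 1\<close> makes the union bound succeed. With
    \<open>c = 48 * m\<close>, a set \<open>A\<close> with more than \<open>N / 48\<close> points
    receives at least \<open>m * N\<close> random values.\<close>
  obtain m :: nat where m: "(95/96 :: real) ^ m < 1/4"
    using real_arch_pow_inv[of "1/4" "95/96"] by auto
  define c where "c = 48 * m"
  show ?thesis
  proof (rule that)
    fix X :: "'a set" and Y :: "'b set"
    assume fin: "finite X" "finite Y" and XY: "card X = card Y"
    define N where "N = card X"
    define F where "F = (X \<times> {..<c}) \<rightarrow>\<^sub>E Y"
    define P where "P = {(A, B). A \<subseteq> X \<and> B \<subseteq> Y \<and> N < 48 * card A \<and> N < 96 * card B}"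
    define Bad where "Bad = (\<lambda>(A, B). {f \<in> F. f ` (A \<times> {..<c}) \<inter> B = {}})"
    have P_sub: "P \<subseteq> Pow X \<times> Pow Y"
      by (auto simp: P_def)
    have finP: "finite P"
      using finite_subset[OF P_sub] fin by simp
    have finF: "finite F"
      unfolding F_def using fin by (intro finite_PiE) auto
    have cardF: "card F = N ^ (N * c)"
      unfolding F_def using fin XY by (simp add: card_PiE N_def card_cartesian_product)
    have cardP: "card P \<le> 4 ^ N"
    proof -
      have "card P \<le> card (Pow X \<times> Pow Y)"
        using P_sub fin by (intro card_mono) auto
      also have "\<dots> = 4 ^ N"
        using fin XY power_mult_distrib[of "2 :: nat" 2 N]
        by (simp add: card_cartesian_product card_Pow N_def)
      finally show ?thesis .
    qed
    have bad: "real (card (Bad p)) \<le> real N ^ (N * c) * ((95/96) ^ m) ^ N" if "p \<in> P" for p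
    proof -
      obtain A B where p: "p = (A, B)" by (cases p)
      have AB: "A \<subseteq> X" "B \<subseteq> Y" "N < 48 * card A" "N < 96 * card B"
        using that by (auto simp: P_def p)
      have finAB: "finite A" "finite B"
        using AB fin by (auto intro: finite_subset)
      \<comment> \<open>Missing \<open>B\<close> confines every value taken on \<open>A\<close> to
        \<open>Y - B\<close>, at most 95/96 of \<open>Y\<close>, so the bad maps lie in a product of
        sets whose size factorises.\<close>
      define T where "T = (\<lambda>(x, i :: nat). if x \<in> A then Y - B else Y)"
      have "Bad p \<subseteq> Pi\<^sub>E (X \<times> {..<c}) T"
      proof
        fix f assume f: "f \<in> Bad p"
        then have "f (x, i) \<notin> B" if "x \<in> A" "i < c" for x i
          using that by (auto simp: Bad_def p)
        then show "f \<in> Pi\<^sub>E (X \<times> {..<c}) T"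
          using f by (auto simp: Bad_def p F_def T_def PiE_iff split: prod.splits)
      qed
      then have "card (Bad p) \<le> card (Pi\<^sub>E (X \<times> {..<c}) T)"
        using fin by (intro card_mono finite_PiE) (auto simp: T_def)
      also have "\<dots> = (\<Prod>q \<in> X \<times> {..<c}. card (T q))"
        using fin by (simp add: card_PiE)
      finally have "real (card (Bad p)) \<le> (\<Prod>q \<in> X \<times> {..<c}. real (card (T q)))"
        by (simp flip: of_nat_prod)
      also have "\<dots> \<le> (\<Prod>q \<in> X \<times> {..<c}. real N * (if fst q \<in> A then 95/96 else 1))"
      proof (rule prod_mono)
        fix q assume "q \<in> X \<times> {..<c}"
        have "card (Y - B) = N - card B" "card B \<le> N"
          using AB fin finAB XY by (auto simp: card_Diff_subset N_def card_mono)
        then have "real (card (Y - B)) \<le> real N * (95/96)"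
          using AB by (simp add: of_nat_diff)
        then show "0 \<le> real (card (T q)) \<and>
            real (card (T q)) \<le> real N * (if fst q \<in> A then 95/96 else 1)"
          using XY by (auto simp: T_def N_def split: prod.splits)
      qed
      also have "\<dots> = real N ^ (N * c) * (\<Prod>q \<in> X \<times> {..<c}. if fst q \<in> A then 95/96 else 1)"
        by (simp add: prod.distrib N_def card_cartesian_product)
      also have "(\<Prod>q \<in> X \<times> {..<c}. if fst q \<in> A then 95/96 else 1) = (95/96 :: real) ^ (card A * c)"
      proof -
        have "(\<Prod>q \<in> X \<times> {..<c}. if fst q \<in> A then 95/96 else 1 :: real)
            = (\<Prod>q \<in> A \<times> {..<c}. 95/96)"
          using AB fin by (intro prod.mono_neutral_cong_right) auto
        then show ?thesis
          by (simp add: card_cartesian_product)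
      qed
      also have "real N ^ (N * c) * (95/96) ^ (card A * c) \<le> real N ^ (N * c) * ((95/96) ^ m) ^ N"
      proof -
        have "m * N \<le> m * (48 * card A)"
          using AB by (intro mult_left_mono) auto
        then have "m * N \<le> card A * c"
          by (simp add: c_def mult_ac)
        then have "(95/96 :: real) ^ (card A * c) \<le> (95/96) ^ (m * N)"
          by (intro power_decreasing) auto
        then show ?thesis
          by (intro mult_left_mono) (auto simp: power_mult)
      qed
      finally show ?thesis .
    qed
    \<comment> \<open>The strict union bound needs \<open>N > 0\<close>, which any member of
      \<open>P\<close> supplies. If \<open>P\<close> is empty, every map in \<open>F\<close> will
      do.\<close>
    have "\<exists>f \<in> F. \<forall>p \<in> P. f \<notin> Bad p"
    proof (cases "P = {}")
      case True
      have "card F > 0"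
        unfolding cardF by (cases "N = 0") auto
      then show ?thesis
        using True by (auto simp: card_gt_0_iff)
    next
      case False
      have N: "N > 0"
      proof -
        obtain A B where "A \<subseteq> X" "0 < card A"
          using False by (force simp: P_def)
        then have "card A \<le> N"
          using fin by (auto simp: N_def card_mono)
        then show ?thesis
          using \<open>0 < card A\<close> by simp
      qed
      have "real (card (\<Union>p \<in> P. Bad p)) \<le> (\<Sum>p \<in> P. real (card (Bad p)))"
        using card_UN_le[OF finP, of Bad] by (simp flip: of_nat_sum)
      also have "\<dots> \<le> (\<Sum>p \<in> P. real N ^ (N * c) * ((95/96) ^ m) ^ N)"
        by (intro sum_mono bad)
      also have "\<dots> \<le> 4 ^ N * (real N ^ (N * c) * ((95/96) ^ m) ^ N)"
      proof -
        have "real (card P) \<le> 4 ^ N"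
          using cardP by (metis of_nat_le_iff of_nat_numeral of_nat_power)
        then show ?thesis
          unfolding sum_constant by (rule mult_right_mono) simp
      qed
      also have "\<dots> = real N ^ (N * c) * (4 * (95/96) ^ m) ^ N"
        by (simp only: power_mult_distrib mult_ac)
      also have "\<dots> < real N ^ (N * c) * 1"
        using m N by (intro mult_strict_left_mono power_less_one_iff[THEN iffD2] zero_less_power) auto
      finally have "card (\<Union>p \<in> P. Bad p) < card F"
        by (simp add: cardF flip: of_nat_power)
      moreover have "(\<Union>p \<in> P. Bad p) \<subseteq> F"
        by (auto simp: Bad_def)
      ultimately have "(\<Union>p \<in> P. Bad p) \<subset> F"
        by blast
      then show ?thesis
        by blast
    qed
    then obtain f where f: "f \<in> F" "\<And>p. p \<in> P \<Longrightarrow> f \<notin> Bad p"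
      by blast
    show "\<exists>f \<in> (X \<times> {..<c}) \<rightarrow> Y. \<forall>A B. A \<subseteq> X \<longrightarrow> B \<subseteq> Y \<longrightarrow>
        card X < 48 * card A \<longrightarrow> card Y < 96 * card B \<longrightarrow> f ` (A \<times> {..<c}) \<inter> B \<noteq> {}"
    proof (intro bexI allI impI)
      fix A B
      assume "A \<subseteq> X" "B \<subseteq> Y" "card X < 48 * card A" "card Y < 96 * card B"
      then have "(A, B) \<in> P"
        using XY by (simp add: P_def N_def)
      then show "f ` (A \<times> {..<c}) \<inter> B \<noteq> {}"
        using f by (auto simp: Bad_def)
    next
      show "f \<in> (X \<times> {..<c}) \<rightarrow> Y"
        using f(1) by (auto simp: F_def)
    qed
  qed
qed

lemma exists_bounded_degree_disperser:
  obtains d :: nat where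
    "\<And>X Y. finite X \<Longrightarrow> finite Y \<Longrightarrow> card X = card Y \<Longrightarrow>
      \<exists>E \<subseteq> X \<times> Y. (\<forall>x. card (E `` {x}) \<le> d) \<and> (\<forall>y. card (E\<inverse> `` {y}) \<le> d) \<and>
        (\<forall>A B. A \<subseteq> X \<longrightarrow> B \<subseteq> Y \<longrightarrow> card X < 48 * card A \<longrightarrow> card Y < 48 * card B \<longrightarrow> 
          E \<inter> A \<times> B \<noteq> {})"
proof -
  obtain c :: nat where c:
    "\<And>X Y. finite (X :: 'a set) \<Longrightarrow> finite (Y :: 'b set) \<Longrightarrow> card X = card Y \<Longrightarrow>
      \<exists>f \<in> (X \<times> {..<c}) \<rightarrow> Y. \<forall>A B. A \<subseteq> X \<longrightarrow> B \<subseteq> Y \<longrightarrow>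
        card X < 48 * card A \<longrightarrow> card Y < 96 * card B \<longrightarrow> f ` (A \<times> {..<c}) \<inter> B \<noteq> {}"
    using exists_map_hitting_dense_sets by metis
  show ?thesis
  proof (rule that)
    fix X :: "'a set" and Y :: "'b set"
    assume fin: "finite X" "finite Y" and XY: "card X = card Y"
    obtain f where f: "f \<in> (X \<times> {..<c}) \<rightarrow> Y" 
      and hit: "\<And>A B. A \<subseteq> X \<Longrightarrow> B \<subseteq> Y \<Longrightarrow> card X < 48 * card A \<Longrightarrow> card Y < 96 * card B \<Longrightarrow>
        f ` (A \<times> {..<c}) \<inter> B \<noteq> {}"
      using c[OF fin XY] by meson
    define Q where "Q = (\<lambda>y. {q \<in> X \<times> {..<c}. f q = y})"
    \<comment> \<open>The fibres of \<open>f\<close> have total size \<open>c * card Y\<close>, so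
      \<open>H\<close> is at most 1/96 of \<open>Y\<close>. A set \<open>B\<close> with density
      above 1/48 therefore keeps density above 1/96 outside \<open>H\<close>, as \<open>hit\<close>
      requires.\<close>
    define H where "H = {y \<in> Y. 96 * c < card (Q y)}"
    define E where "E = {(x, y). x \<in> X \<and> y \<in> Y - H \<and> (\<exists>i<c. f (x, i) = y)}"
    have finQ: "finite (Q y)" for y
      using fin by (auto simp: Q_def)
    have H: "96 * card H \<le> card Y"
    proof -
      have "c * (96 * card H) = (\<Sum>y \<in> H. 96 * c)"
        by simp
      also have "\<dots> \<le> (\<Sum>y \<in> H. card (Q y))"
        by (intro sum_mono) (auto simp: H_def)
      also have "\<dots> = card (\<Union>y \<in> H. Q y)"
        using fin finQ by (subst card_UN_disjoint) (auto simp: H_def Q_def)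
      also have "\<dots> \<le> card (X \<times> {..<c})"
        using fin by (intro card_mono) (auto simp: Q_def)
      also have "\<dots> = c * card Y"
        by (simp add: card_cartesian_product XY)
      finally have "c * (96 * card H) \<le> c * card Y" .
      \<comment> \<open>Cancelling \<open>c\<close> needs \<open>c > 0\<close>; for
        \<open>c = 0\<close> all fibres are empty and so is \<open>H\<close>.\<close>
      moreover have "H = {}" if "c = 0"
        using that by (auto simp: H_def Q_def)
      ultimately show ?thesis
        by (cases "c = 0") auto
    qed
    show "\<exists>E \<subseteq> X \<times> Y. (\<forall>x. card (E `` {x}) \<le> 96 * c) \<and> (\<forall>y. card (E\<inverse> `` {y}) \<le> 96 * c) \<and>
        (\<forall>A B. A \<subseteq> X \<longrightarrow> B \<subseteq> Y \<longrightarrow> card X < 48 * card A \<longrightarrow> card Y < 48 * card B \<longrightarrow>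
          E \<inter> A \<times> B \<noteq> {})"
    proof (intro exI[of _ E] conjI allI impI)
      show "E \<subseteq> X \<times> Y"
        by (auto simp: E_def)
    next
      fix x
      have "E `` {x} \<subseteq> (\<lambda>i. f (x, i)) ` {..<c}"
        by (auto simp: E_def)
      then have "card (E `` {x}) \<le> c"
        using surj_card_le[of "{..<c}"] by simp
      then show "card (E `` {x}) \<le> 96 * c"
        by simp
    next
      fix y
      show "card (E\<inverse> `` {y}) \<le> 96 * c"
      proof (cases "y \<in> Y - H")
        case True
        have "E\<inverse> `` {y} \<subseteq> fst ` Q y"
          by (force simp: E_def Q_def)
        then have "card (E\<inverse> `` {y}) \<le> card (Q y)"
          using finQ by (rule surj_card_le[rotated])
        then show ?thesis
          using True by (auto simp: H_def)
      next
        case False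
        then have "E\<inverse> `` {y} = {}"
          by (auto simp: E_def)
        then show ?thesis by simp
      qed
    next
      fix A B
      assume AB: "A \<subseteq> X" "B \<subseteq> Y" "card X < 48 * card A" "card Y < 48 * card B"
      have "finite H" 
        using fin by (simp add: H_def)
      then have "card B - card H \<le> card (B - H)"
        by (rule diff_card_le_card_Diff)
      then have "card Y < 96 * card (B - H)"
        using AB H by linarith
      then have "f ` (A \<times> {..<c}) \<inter> (B - H) \<noteq> {}"
        using AB by (intro hit) auto
      then show "E \<inter> A \<times> B \<noteq> {}"
        using AB by (fastforce simp: E_def)
    qed
  qed
qed

section \<open>Thresholds\<close>

text \<open>Summation over the fibres of \<open>g\<close>. It adds up the exceptional sets of the
  separate dispersers.\<close>

lemma card_le_fibrewise:
  assumes "finite V"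
    and "\<And>v. v \<in> V \<Longrightarrow> c * card {x \<in> V. g x = g v \<and> P x} \<le> card {x \<in> V. g x = g v}"
  shows "c * card {x \<in> V. P x} \<le> card V"
proof -
  have "c * card {x \<in> V. P x} = c * (\<Sum>y \<in> g ` V. card {x \<in> {x \<in> V. P x}. g x = y})"
    using assms(1) by (subst card_eq_sum[of "{x \<in> V. P x}"], subst sum.group[symmetric, where T = "g ` V" and g = g]) auto
  also have "\<dots> = (\<Sum>y \<in> g ` V. c * card {x \<in> V. g x = y \<and> P x})"
    by (simp add: sum_distrib_left conj_ac Collect_conj_eq Int_ac)
  also have "\<dots> \<le> (\<Sum>y \<in> g ` V. card {x \<in> V. g x = y})"
    using assms(2) by (intro sum_mono) auto
  also have "\<dots> = card V"
    using assms(1) by (subst card_eq_sum[of V], subst sum.group[symmetric, where T = "g ` V" and g = g]) auto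
  finally show ?thesis .
qed

text \<open>Take the least \<open>s\<close> for which few labels on \<open>X\<close> reach
  \<open>s\<close>; it is at most \<open>Suc L\<close> because no label on \<open>X\<close> exceeds
  \<open>L\<close>. If \<open>s = Suc r\<close>, the points of \<open>X\<close> with label at least
  \<open>r\<close> are dense, yet no arc leads from them to a label below \<open>s\<close>, as
  labels increase strictly. Hence the disperser forces the points of \<open>Y\<close> with label
  below \<open>s\<close> to be sparse. For \<open>s = 0\<close> there are no such points.\<close>

lemma threshold_of_disperser:
  fixes l :: "'v \<Rightarrow> nat"
  assumes fin: "finite X" "finite Y"
    and E: "\<And>A B. A \<subseteq> X \<Longrightarrow> B \<subseteq> Y \<Longrightarrow> card X < 48 * card A \<Longrightarrow> card Y < 48 * card B \<Longrightarrow>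
      E \<inter> A \<times> B \<noteq> {}"
    and mono: "\<And>u v. (u, v) \<in> E \<Longrightarrow> u \<notin> S \<Longrightarrow> v \<notin> S \<Longrightarrow> l u < l v"
    and le: "\<And>v. v \<in> X - S \<Longrightarrow> l v \<le> L"
  shows "\<exists>s \<le> Suc L. 48 * card {x \<in> X - S. s \<le> l x} \<le> card X \<and>
    48 * card {y \<in> Y - S. l y < s} \<le> card Y"
proof -
  define P where "P s \<longleftrightarrow> 48 * card {x \<in> X - S. s \<le> l x} \<le> card X" for s
  have no_large: "{x \<in> X - S. Suc L \<le> l x} = {}"
    using le by fastforce
  have P_Suc: "P (Suc L)"
    unfolding P_def no_large by simp
  define s where "s = (LEAST s. P s)"
  have s: "P s" "s \<le> Suc L"
    using P_Suc by (auto simp: s_def intro: LeastI Least_le)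
  have "48 * card {y \<in> Y - S. l y < s} \<le> card Y"
  proof (cases s)
    case (Suc r)
    then have "\<not> P r"
      using not_less_Least[of r P] by (simp add: s_def)
    then have "card X < 48 * card {x \<in> X - S. r \<le> l x}"
      by (simp add: P_def)
    moreover have "E \<inter> {x \<in> X - S. r \<le> l x} \<times> {y \<in> Y - S. l y < s} = {}"
      using mono Suc by fastforce
    ultimately show ?thesis
      using E[of "{x \<in> X - S. r \<le> l x}" "{y \<in> Y - S. l y < s}"] by fastforce
  qed simp
  then show ?thesis
    using s by (auto simp: P_def)
qed

section \<open>Digraphs assembled from one disperser per position and prefix\<close>

lemma bij_betw_flip:
  fixes W :: "'w set"
  assumes "j < n"
  shows "bij_betw (\<lambda>(t, w). (t[j := \<not> t ! j], w))
    {(t, w). length t = n \<and> w \<in> W \<and> take j t = p \<and> t ! j = c \<and> s w = j}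
    {(t, w). length t = n \<and> w \<in> W \<and> take j t = p \<and> t ! j = (\<not> c) \<and> s w = j}"
  by (rule bij_betw_byWitness[where f' = "\<lambda>(t, w). (t[j := \<not> t ! j], w)"])
    (use assms in \<open>auto simp: list_update_same_conv\<close>)

text \<open>A vertex \<open>(t, w)\<close> is tested at position \<open>s w\<close>. The set
  \<open>S\<close> and the labelling \<open>l\<close> are quantified inside, so digraphs for
  different \<open>s\<close> can be united and one labelling of the union used for all of them. The
  fixed lexicographic order on the strings keeps such a union acyclic.\<close>

definition threshold_digraph ::
  "nat \<Rightarrow> nat \<Rightarrow> 'w set \<Rightarrow> ('w \<Rightarrow> nat) \<Rightarrow> ((bool list \<times> 'w) \<times> (bool list \<times> 'w)) set \<Rightarrow> bool" where
  "threshold_digraph d n W s E \<longleftrightarrow>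
    E \<subseteq> ({t. length t = n} \<times> W) \<times> ({t. length t = n} \<times> W) \<and>
    (\<forall>v. card (E `` {v}) \<le> d) \<and> (\<forall>v. card (E\<inverse> `` {v}) \<le> d) \<and>
    (\<forall>(u, v) \<in> E. (fst u, fst v) \<in> lex {(False, True)}) \<and>
    (\<forall>S (l :: bool list \<times> 'w \<Rightarrow> nat) L.
      (\<forall>(u, v) \<in> E. u \<notin> S \<longrightarrow> v \<notin> S \<longrightarrow> l u < l v) \<longrightarrow>
      (\<forall>v \<in> {t. length t = n} \<times> W - S. l v \<le> L) \<longrightarrow>
      (\<exists>\<theta>. (\<forall>j p. \<theta> j p \<le> Suc L) \<and>
        48 * card {(t, w). length t = n \<and> w \<in> W \<and> (t, w) \<notin> S \<and>
            t ! s w \<noteq> (\<theta> (s w) (take (s w) t) \<le> l (t, w))}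
          \<le> 2 ^ n * card W))"

lemma threshold_digraphD:
  assumes "threshold_digraph d n W s E"
  shows "E \<subseteq> ({t. length t = n} \<times> W) \<times> ({t. length t = n} \<times> W)"
    and "card (E `` {v}) \<le> d" and "card (E\<inverse> `` {v}) \<le> d"
    and "(u, v) \<in> E \<Longrightarrow> (fst u, fst v) \<in> lex {(False, True)}"
    and "(\<And>u v. (u, v) \<in> E \<Longrightarrow> u \<notin> S \<Longrightarrow> v \<notin> S \<Longrightarrow> l u < l v) \<Longrightarrow>
      (\<And>v. v \<in> {t. length t = n} \<times> W - S \<Longrightarrow> l v \<le> L) \<Longrightarrow>
      \<exists>\<theta>. (\<forall>j p. \<theta> j p \<le> Suc L) \<and>
        48 * card {(t, w). length t = n \<and> w \<in> W \<and> (t, w) \<notin> S \<and>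
            t ! s w \<noteq> (\<theta> (s w) (take (s w) t) \<le> l (t, w))}
          \<le> 2 ^ n * card W"
proof -
  note E = assms[unfolded threshold_digraph_def]
  show "E \<subseteq> ({t. length t = n} \<times> W) \<times> ({t. length t = n} \<times> W)"
    by (rule E[THEN conjunct1])
  show "card (E `` {v}) \<le> d"
    by (rule E[THEN conjunct2, THEN conjunct1, rule_format])
  show "card (E\<inverse> `` {v}) \<le> d"
    by (rule E[THEN conjunct2, THEN conjunct2, THEN conjunct1, rule_format])
  show "(fst u, fst v) \<in> lex {(False, True)}" if "(u, v) \<in> E"
    using E[THEN conjunct2, THEN conjunct2, THEN conjunct2, THEN conjunct1] that by fast
  show "\<exists>\<theta>. (\<forall>j p. \<theta> j p \<le> Suc L) \<and>
        48 * card {(t, w). length t = n \<and> w \<in> W \<and> (t, w) \<notin> S \<and>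
            t ! s w \<noteq> (\<theta> (s w) (take (s w) t) \<le> l (t, w))}
          \<le> 2 ^ n * card W"
    if "\<And>u v. (u, v) \<in> E \<Longrightarrow> u \<notin> S \<Longrightarrow> v \<notin> S \<Longrightarrow> l u < l v"
      "\<And>v. v \<in> {t. length t = n} \<times> W - S \<Longrightarrow> l v \<le> L"
    by (rule E[THEN conjunct2, THEN conjunct2, THEN conjunct2, THEN conjunct2, rule_format])
      (use that in \<open>auto split: prod.splits\<close>)
qed

text \<open>One \<open>d\<close> serves all \<open>n\<close>, \<open>W\<close> and \<open>s\<close>:
  the position and prefix of a vertex determine its block pair, so each vertex meets only one
  disperser and degrees do not accumulate over positions.\<close>

lemma exists_threshold_digraph:
  "\<exists>d. \<forall>(W :: 'w set) s n. finite W \<longrightarrow> (\<forall>w \<in> W. s w < n) \<longrightarrow> (\<exists>E. threshold_digraph d n W s E)"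
proof -
  obtain d :: nat where d:
    "\<And>X Y. finite (X :: (bool list \<times> 'w) set) \<Longrightarrow> finite (Y :: (bool list \<times> 'w) set) \<Longrightarrow>
      card X = card Y \<Longrightarrow>
      \<exists>E \<subseteq> X \<times> Y. (\<forall>x. card (E `` {x}) \<le> d) \<and> (\<forall>y. card (E\<inverse> `` {y}) \<le> d) \<and>
        (\<forall>A B. A \<subseteq> X \<longrightarrow> B \<subseteq> Y \<longrightarrow> card X < 48 * card A \<longrightarrow> card Y < 48 * card B \<longrightarrow>
          E \<inter> A \<times> B \<noteq> {})"
    using exists_bounded_degree_disperser by metis
  show ?thesis
  proof (intro exI[of _ d] allI impI)
    fix W :: "'w set" and s :: "'w \<Rightarrow> nat" and n
    assume finW: "finite W" and "\<forall>w \<in> W. s w < n"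
    then have s: "\<And>w. w \<in> W \<Longrightarrow> s w < n"
      by blast
    define V where "V = {t :: bool list. length t = n} \<times> W"
    define block where "block j p c = {(t, w). length t = n \<and> w \<in> W \<and> take j t = p \<and> t ! j = c \<and> s w = j}"
      for j and p :: "bool list" and c
    have finT: "finite {t :: bool list. length t = n}" and cardT: "card {t :: bool list. length t = n} = 2 ^ n"
      using finite_lists_length_eq[of "UNIV :: bool set" n] card_lists_length_eq[of "UNIV :: bool set" n]
      by (auto simp: card_UNIV_bool)
    have finV: "finite V" and cardV: "card V = 2 ^ n * card W"
      using finT finW cardT by (auto simp: V_def card_cartesian_product)
    have block_V: "block j p c \<subseteq> V" for j p c
      by (auto simp: block_def V_def)
    have fin_block: "finite (block j p c)" for j p c
      using block_V finV by (rule finite_subset)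
    \<comment> \<open>Flipping bit \<open>j\<close> exchanges the two halves and keeps the prefix
      and \<open>w\<close>; dispersers are available only between sets of equal size.\<close>
    have "card (block j p False) = card (block j p True)" for j p
    proof (cases "j < n")
      case True
      then show ?thesis
        using bij_betw_same_card[OF bij_betw_flip[OF True, of W p False s]] by (simp add: block_def)
    next
      case False
      then have "block j p c = {}" for c
        using s by (auto simp: block_def)
      then show ?thesis by simp
    qed
    then have "\<exists>E \<subseteq> block j p False \<times> block j p True.
        (\<forall>x. card (E `` {x}) \<le> d) \<and> (\<forall>y. card (E\<inverse> `` {y}) \<le> d) \<and>
        (\<forall>A B. A \<subseteq> block j p False \<longrightarrow> B \<subseteq> block j p True \<longrightarrow>
          card (block j p False) < 48 * card A \<longrightarrow> card (block j p True) < 48 * card B \<longrightarrow>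
          E \<inter> A \<times> B \<noteq> {})" for j p
      by (intro d fin_block)
    then obtain E where E_sub: "\<And>j p. E j p \<subseteq> block j p False \<times> block j p True"
      and E_out: "\<And>j p x. card (E j p `` {x}) \<le> d" and E_in: "\<And>j p x. card ((E j p)\<inverse> `` {x}) \<le> d"
      and E_disp: "\<And>j p A B. A \<subseteq> block j p False \<Longrightarrow> B \<subseteq> block j p True \<Longrightarrow>
          card (block j p False) < 48 * card A \<Longrightarrow> card (block j p True) < 48 * card B \<Longrightarrow>
          E j p \<inter> A \<times> B \<noteq> {}"
      by metis
    define D where "D = (\<Union>j p. E j p)"
    \<comment> \<open>Either endpoint of an arc determines which disperser it came from, which
      yields both degree bounds.\<close>
    have D_E: "(u, v) \<in> E (s (snd u)) (take (s (snd u)) (fst u))"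
      "(u, v) \<in> E (s (snd v)) (take (s (snd v)) (fst v))" if uv: "(u, v) \<in> D" for u v
    proof -
      obtain j p where "(u, v) \<in> E j p"
        using uv by (auto simp: D_def)
      with E_sub[of j p] have "(u, v) \<in> E j p" "u \<in> block j p False" "v \<in> block j p True"
        by auto
      then show "(u, v) \<in> E (s (snd u)) (take (s (snd u)) (fst u))"
        "(u, v) \<in> E (s (snd v)) (take (s (snd v)) (fst v))"
        by (auto simp: block_def)
    qed
    show "\<exists>E. threshold_digraph d n W s E"
      unfolding threshold_digraph_def V_def[symmetric]
    proof (intro exI[of _ D] conjI allI impI)
      show "D \<subseteq> V \<times> V"
        using E_sub block_V by (fastforce simp: D_def)
    next
      fix v
      have "D `` {v} \<subseteq> E (s (snd v)) (take (s (snd v)) (fst v)) `` {v}"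
        using D_E(1) by auto
      moreover have "finite (E (s (snd v)) (take (s (snd v)) (fst v)) `` {v})"
        by (rule finite_subset[OF _ finV]) (use E_sub block_V in blast)
      ultimately show "card (D `` {v}) \<le> d"
        using E_out card_mono le_trans by metis
    next
      fix v
      have "D\<inverse> `` {v} \<subseteq> (E (s (snd v)) (take (s (snd v)) (fst v)))\<inverse> `` {v}"
        using D_E(2) by auto
      moreover have "finite ((E (s (snd v)) (take (s (snd v)) (fst v)))\<inverse> `` {v})"
        by (rule finite_subset[OF _ finV]) (use E_sub block_V in blast)
      ultimately show "card (D\<inverse> `` {v}) \<le> d"
        using E_in card_mono le_trans by metis
    next
      show "\<forall>(u, v) \<in> D. (fst u, fst v) \<in> lex {(False, True)}"
      proof clarify
        fix t w t' w' assume "((t, w), (t', w')) \<in> D"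
        then obtain j p where "((t, w), (t', w')) \<in> E j p"
          by (auto simp: D_def)
        then have "(t, w) \<in> block j p False" "(t', w') \<in> block j p True"
          using E_sub by auto
        then have j: "j < length t" "length t = length t'" "take j t = take j t'" "\<not> t ! j" "t' ! j"
          using s by (auto simp: block_def)
        then have "(t, t') \<in> lexord {(False, True)}"
          unfolding lexord_take_index_conv by auto
        then show "(fst (t, w), fst (t', w')) \<in> lex {(False, True)}"
          using j by (simp add: lexord_lex)
      qed
    next
      fix S and l :: "bool list \<times> 'w \<Rightarrow> nat" and L :: nat
      assume mono: "\<forall>(u, v) \<in> D. u \<notin> S \<longrightarrow> v \<notin> S \<longrightarrow> l u < l v"
        and le: "\<forall>v \<in> V - S. l v \<le> L"
      have mono': "l u < l v" if "(u, v) \<in> E j p" "u \<notin> S" "v \<notin> S" for u v j p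
        using that mono unfolding D_def by blast
      have le': "l v \<le> L" if "v \<in> block j p False - S" for v j p
        using that le subsetD[OF block_V] by blast
      have "\<exists>r \<le> Suc L. 48 * card {x \<in> block j p False - S. r \<le> l x} \<le> card (block j p False) \<and>
          48 * card {y \<in> block j p True - S. l y < r} \<le> card (block j p True)" for j p
        by (rule threshold_of_disperser[OF fin_block fin_block E_disp mono' le'])
      then have "\<exists>\<theta>. \<forall>j p. \<theta> j p \<le> Suc L \<and>
          48 * card {x \<in> block j p False - S. \<theta> j p \<le> l x} \<le> card (block j p False) \<and>
          48 * card {y \<in> block j p True - S. l y < \<theta> j p} \<le> card (block j p True)"
        by (intro choice allI)
      then obtain \<theta> where \<theta>: "\<And>j p. \<theta> j p \<le> Suc L"
        "\<And>j p. 48 * card {x \<in> block j p False - S. \<theta> j p \<le> l x} \<le> card (block j p False)"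
        "\<And>j p. 48 * card {y \<in> block j p True - S. l y < \<theta> j p} \<le> card (block j p True)"
        by blast
      define wrong where "wrong v \<longleftrightarrow> v \<notin> S \<and> fst v ! s (snd v) \<noteq> (\<theta> (s (snd v)) (take (s (snd v)) (fst v)) \<le> l v)" for v
      \<comment> \<open>The fibre of \<open>g\<close> through a vertex is its pair of blocks. Wrong
        vertices of the \<open>False\<close> half reach the threshold and those of the
        \<open>True\<close> half stay below it; each kind makes up at most 1/48 of its half.\<close>
      define g where "g v = (s (snd v), take (s (snd v)) (fst v))" for v :: "bool list \<times> 'w"
      have "48 * card {v \<in> V. wrong v} \<le> card V"
      proof (rule card_le_fibrewise[OF finV, where g = g])
        fix v assume "v \<in> V"
        define j p where "j = s (snd v)" and "p = take j (fst v)"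
        have "{x \<in> V. g x = g v \<and> wrong x} =
            {x \<in> block j p False - S. \<theta> j p \<le> l x} \<union> {y \<in> block j p True - S. l y < \<theta> j p}"
          by (auto simp: V_def g_def wrong_def block_def j_def p_def)
        then have "card {x \<in> V. g x = g v \<and> wrong x} \<le>
            card {x \<in> block j p False - S. \<theta> j p \<le> l x} + card {y \<in> block j p True - S. l y < \<theta> j p}"
          by (simp add: card_Un_le)
        then have "48 * card {x \<in> V. g x = g v \<and> wrong x} \<le> card (block j p False) + card (block j p True)"
          using \<theta>(2,3)[of j p] by linarith
        also have "\<dots> = card (block j p False \<union> block j p True)"
          by (rule card_Un_disjoint[OF fin_block fin_block, symmetric]) (auto simp: block_def)
        also have "block j p False \<union> block j p True = {x \<in> V. g x = g v}"
          by (auto simp: V_def g_def block_def j_def p_def)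
        finally show "48 * card {x \<in> V. g x = g v \<and> wrong x} \<le> card {x \<in> V. g x = g v}" .
      qed
      moreover have "{(t, w). length t = n \<and> w \<in> W \<and> (t, w) \<notin> S \<and>
                t ! s w \<noteq> (\<theta> (s w) (take (s w) t) \<le> l (t, w))} = {v \<in> V. wrong v}"
        by (auto simp: V_def wrong_def)
      ultimately have "48 * card {(t, w). length t = n \<and> w \<in> W \<and> (t, w) \<notin> S \<and>
                t ! s w \<noteq> (\<theta> (s w) (take (s w) t) \<le> l (t, w))} \<le> 2 ^ n * card W"
        by (simp only: cardV)
      then show "\<exists>\<theta>. (\<forall>j p. \<theta> j p \<le> Suc L) \<and>
            48 * card {(t, w). length t = n \<and> w \<in> W \<and> (t, w) \<notin> S \<and>
                t ! s w \<noteq> (\<theta> (s w) (take (s w) t) \<le> l (t, w))}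
              \<le> 2 ^ n * card W"
        using \<theta>(1) by blast
    qed
  qed
qed

section \<open>Online prediction of bits\<close>

lemma sum_length_Suc:
  "(\<Sum>t | length t = Suc n. g t) =
    (\<Sum>t | length t = n. g (True # t)) + (\<Sum>t | length t = n. g (False # t) :: 'a :: comm_monoid_add)"
proof -
  have fin: "finite {t :: bool list. length t = n}"
    using finite_lists_length_eq[of "UNIV :: bool set" n] by simp
  have "{t. length t = Suc n} = (#) True ` {t. length t = n} \<union> (#) False ` {t. length t = n}"
    by (auto simp: length_Suc_conv image_iff)
  then have "(\<Sum>t | length t = Suc n. g t) =
      (\<Sum>t \<in> (#) True ` {t. length t = n}. g t) + (\<Sum>t \<in> (#) False ` {t. length t = n}. g t)"
    using fin by (simp only:) (rule sum.union_disjoint; auto)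
  then show ?thesis
    by (simp add: sum.reindex)
qed

text \<open>Among all bit strings, the errors of an online predictor are distributed as independent
  fair coin flips.\<close>

lemma sum_power_prediction_errors:
  fixes w :: real and f :: "bool list \<Rightarrow> bool"
  assumes "k \<le> n"
  shows "(\<Sum>t | length t = n. w ^ card {a. a < k \<and> t ! a \<noteq> f (take a t)}) = (1 + w) ^ k * 2 ^ (n - k)"
  using assms
proof (induction k arbitrary: n f)
  case 0
  show ?case
    using card_lists_length_eq[of "UNIV :: bool set" n] by (simp add: card_UNIV_bool)
next
  case (Suc k)
  then obtain m where m: "n = Suc m" "k \<le> m"
    by (cases n) auto
  \<comment> \<open>Fixing the first bit \<open>x\<close> leaves an online predictor for the tail,
    namely \<open>f\<close> with \<open>x\<close> prepended to its input.\<close>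
  have err: "card {a. a < Suc k \<and> (x # t) ! a \<noteq> f (take a (x # t))} =
      of_bool (x \<noteq> f []) + card {a. a < k \<and> t ! a \<noteq> f (x # take a t)}" for x t
  proof -
    have "{a. a < Suc k \<and> (x # t) ! a \<noteq> f (take a (x # t))} =
        {a. a = 0 \<and> x \<noteq> f []} \<union> Suc ` {a. a < k \<and> t ! a \<noteq> f (x # take a t)}"
      by (auto simp: less_Suc_eq_0_disj image_iff)
    moreover have "card ({a. a = 0 \<and> x \<noteq> f []} \<union> Suc ` {a. a < k \<and> t ! a \<noteq> f (x # take a t)}) =
        card {a :: nat. a = 0 \<and> x \<noteq> f []} + card {a. a < k \<and> t ! a \<noteq> f (x # take a t)}"
      by (subst card_Un_disjoint) (auto simp: card_image)
    ultimately show ?thesis by simp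
  qed
  have step: "(\<Sum>t | length t = m. w ^ card {a. a < Suc k \<and> (x # t) ! a \<noteq> f (take a (x # t))}) =
      w ^ of_bool (x \<noteq> f []) * ((1 + w) ^ k * 2 ^ (m - k))" for x
    unfolding err power_add sum_distrib_left[symmetric] using Suc.IH[OF m(2), of "\<lambda>p. f (x # p)"] by simp
  show ?case
    unfolding m(1) sum_length_Suc step by (cases "f []") (auto simp: algebra_simps)
qed

text \<open>Exponential Markov inequality with weight \<open>w = 256/625 = (4/5) ^ 4\<close> per
  error: a string counted here has weight at least \<open>(4/5) ^ k\<close>, and
  \<open>(1 + w) / (4/5) = 881/500\<close>. The weight \<open>1/3\<close> would be optimal; a fourth
  power keeps the base rational.\<close>

lemma card_few_prediction_errors:
  fixes f :: "bool list \<Rightarrow> bool"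
  assumes "k \<le> n"
  shows "real (card {t. length t = n \<and> 4 * card {a. a < k \<and> t ! a \<noteq> f (take a t)} \<le> k})
    \<le> (881 / 500) ^ k * 2 ^ (n - k)"
proof -
  define e where "e t = card {a. a < k \<and> t ! a \<noteq> f (take a t)}" for t
  have fin: "finite {t :: bool list. length t = n}"
    using finite_lists_length_eq[of "UNIV :: bool set" n] by simp
  have "real (card {t. length t = n \<and> 4 * e t \<le> k}) * (4/5) ^ k =
      (\<Sum>t | length t = n \<and> 4 * e t \<le> k. (4/5) ^ k)"
    by simp
  also have "\<dots> \<le> (\<Sum>t | length t = n \<and> 4 * e t \<le> k. (256/625) ^ e t)"
  proof (rule sum_mono)
    fix t assume "t \<in> {t. length t = n \<and> 4 * e t \<le> k}"
    then have "(4/5 :: real) ^ k \<le> (4/5) ^ (4 * e t)"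
      by (intro power_decreasing) auto
    then show "(4/5 :: real) ^ k \<le> (256/625) ^ e t"
      by (simp add: power_mult power_divide)
  qed
  also have "\<dots> \<le> (\<Sum>t | length t = n. (256/625) ^ e t)"
    using fin by (intro sum_mono2) auto
  also have "\<dots> = (881/625) ^ k * 2 ^ (n - k)"
    using sum_power_prediction_errors[OF assms, of "256/625" f] by (simp add: e_def)
  finally have "real (card {t. length t = n \<and> 4 * e t \<le> k}) \<le> (881/625) ^ k * 2 ^ (n - k) / (4/5) ^ k"
    by (simp add: pos_le_divide_eq)
  also have "\<dots> = ((881/625) / (4/5)) ^ k * 2 ^ (n - k)"
    by (simp only: power_divide mult_ac times_divide_eq_right)
  finally show ?thesis
    by (simp add: e_def)
qed

lemma threshold_count_bound:
  fixes \<theta> \<phi> :: "nat \<Rightarrow> bool list \<Rightarrow> nat"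
  assumes K: "0 < K" and \<phi>: "\<And>j p. \<phi> j p \<le> M"
    and few: "8 * card {(t, a, b). length t = 2 * K \<and> a < K \<and> b \<in> {K..<2*K} \<and>
        t ! a \<noteq> (\<theta> a (take a t) < \<phi> b (take b t))} \<le> 4 ^ K * (K * K)"
  shows "2 ^ K \<le> 2 * (real M + 1) * (881 / 500) ^ K"
proof -
  define T where "T = {t :: bool list. length t = 2 * K}"
  have finT: "finite T" and cardT: "card T = 4 ^ K"
    using finite_lists_length_eq[of "UNIV :: bool set" "2 * K"]
      card_lists_length_eq[of "UNIV :: bool set" "2 * K"]
    by (auto simp: T_def card_UNIV_bool power_mult)
  define err where "err r t = card {a. a < K \<and> t ! a \<noteq> (\<theta> a (take a t) < r)}" for r t
  define e where "e b t = err (\<phi> b (take b t)) t" for b t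
  have "(\<Sum>b \<in> {K..<2*K}. \<Sum>t \<in> T. e b t) =
      card (SIGMA b:{K..<2*K}. SIGMA t:T. {a. a < K \<and> t ! a \<noteq> (\<theta> a (take a t) < \<phi> b (take b t))})"
    using finT by (simp add: card_SigmaI e_def err_def)
  also have "\<dots> = card {(t, a, b). length t = 2 * K \<and> a < K \<and> b \<in> {K..<2*K} \<and>
        t ! a \<noteq> (\<theta> a (take a t) < \<phi> b (take b t))}"
    by (rule bij_betw_same_card[of "\<lambda>(b, t, a). (t, a, b)"],
        rule bij_betw_byWitness[where f' = "\<lambda>(t, a, b). (b, t, a)"]) (auto simp: T_def)
  finally have "8 * (\<Sum>b \<in> {K..<2*K}. \<Sum>t \<in> T. e b t) \<le> 4 ^ K * (K * K)"
    using few by (simp only:)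
  then have total: "(\<Sum>b \<in> {K..<2*K}. 8 * (\<Sum>t \<in> T. e b t)) \<le> (\<Sum>b \<in> {K..<2*K}. 4 ^ K * K)"
    by (simp add: mult.left_commute flip: sum_distrib_left)
  have "\<exists>b \<in> {K..<2*K}. 8 * (\<Sum>t \<in> T. e b t) \<le> 4 ^ K * K"
  proof (rule ccontr)
    assume "\<not> ?thesis"
    then have "(\<Sum>b \<in> {K..<2*K}. 4 ^ K * K) < (\<Sum>b \<in> {K..<2*K}. 8 * (\<Sum>t \<in> T. e b t))"
      using K by (intro sum_strict_mono) (auto simp: not_le)
    with total show False by simp
  qed
  then obtain b where b: "8 * (\<Sum>t \<in> T. e b t) \<le> 4 ^ K * K"
    by blast
  \<comment> \<open>The mean error at this \<open>b\<close> is at most \<open>K / 8\<close>, so at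
    most half of the strings have more than \<open>K / 4\<close> errors.\<close>
  define H where "H = {t \<in> T. K < 4 * e b t}"
  have "K * card H = (\<Sum>t \<in> H. K)"
    by simp
  also have "\<dots> \<le> (\<Sum>t \<in> H. 4 * e b t)"
    by (intro sum_mono) (auto simp: H_def)
  also have "\<dots> \<le> (\<Sum>t \<in> T. 4 * e b t)"
    using finT by (intro sum_mono2) (auto simp: H_def)
  finally have "K * card H \<le> 4 * (\<Sum>t \<in> T. e b t)"
    by (simp only: sum_distrib_left)
  with b have "2 * (K * card H) \<le> 4 ^ K * K"
    by linarith
  then have "K * (2 * card H) \<le> K * 4 ^ K"
    by (simp only: mult_ac)
  then have "2 * card H \<le> 4 ^ K"
    using K by simp
  moreover have "card (T - H) = 4 ^ K - card H"
    using finT cardT by (subst card_Diff_subset) (auto simp: H_def)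
  ultimately have good: "4 ^ K \<le> 2 * card (T - H)"
    by linarith
  define Gd where "Gd r = {t \<in> T. 4 * err r t \<le> K}" for r
  have card_Gd: "real (card (Gd r)) \<le> (881 / 500) ^ K * 2 ^ K" for r
  proof -
    \<comment> \<open>The position \<open>a\<close> is recovered as the length of the prefix, so the
      prediction is a function of the prefix alone.\<close>
    have "err r t = card {a. a < K \<and> t ! a \<noteq> (\<theta> (length (take a t)) (take a t) < r)}" if "t \<in> T" for t
      using that by (auto simp: err_def T_def intro!: arg_cong[where f = card])
    then have "Gd r = {t. length t = 2 * K \<and> 4 * card {a. a < K \<and> t ! a \<noteq> (\<theta> (length (take a t)) (take a t) < r)} \<le> K}"
      by (auto simp: Gd_def T_def)
    then show ?thesis
      using card_few_prediction_errors[of K "2 * K" "\<lambda>p. \<theta> (length p) p < r"] by simp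
  qed
  have "T - H \<subseteq> (\<Union>r \<in> {..M}. Gd r)"
    using \<phi> by (force simp: H_def Gd_def e_def not_less)
  then have "card (T - H) \<le> card (\<Union>r \<in> {..M}. Gd r)"
    using finT by (intro card_mono) (auto simp: Gd_def)
  also have "\<dots> \<le> (\<Sum>r\<le>M. card (Gd r))"
    by (rule card_UN_le) simp
  finally have "real (card (T - H)) \<le> (\<Sum>r\<le>M. real (card (Gd r)))"
    by (simp flip: of_nat_sum)
  also have "\<dots> \<le> (\<Sum>r\<le>M. (881 / 500) ^ K * 2 ^ K)"
    by (intro sum_mono card_Gd)
  also have "\<dots> = (real M + 1) * (881 / 500) ^ K * 2 ^ K"
    by (simp add: algebra_simps)
  finally have "4 ^ K \<le> 2 * ((real M + 1) * (881 / 500) ^ K * 2 ^ K)"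
    using good by (simp flip: of_nat_le_iff[where ?'a = real])
  moreover have "(4 :: real) ^ K = 2 ^ K * 2 ^ K"
    by (simp flip: power_mult_distrib)
  ultimately have "2 ^ K * 2 ^ K \<le> (2 * (real M + 1) * (881 / 500) ^ K) * 2 ^ K"
    by (simp only: mult_ac)
  then show ?thesis
    by (rule mult_right_le_imp_le) simp
qed

text \<open>Flipping bit \<open>b > a\<close> changes neither bit \<open>a\<close> nor the prefixes on which the two thresholds
  depend. If the label of \<open>(t, a, b)\<close> predicts bits \<open>a\<close> and \<open>b\<close> both before and after the flip,
  the two labels lie on the same side of the first threshold and on different sides of the second,
  so that comparing the thresholds predicts bit \<open>a\<close>.\<close>

lemma card_threshold_comparison_errors:
  fixes l :: "bool list \<times> nat \<times> nat \<Rightarrow> nat"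
  assumes V: "V = {t. length t = 2 * K} \<times> {..<K} \<times> {K..<2*K}"
    and S: "48 * card (S \<inter> V) \<le> card V"
    and \<theta>: "48 * card {(t, w). length t = 2 * K \<and> w \<in> {..<K} \<times> {K..<2*K} \<and> (t, w) \<notin> S \<and>
        t ! fst w \<noteq> (\<theta> (fst w) (take (fst w) t) \<le> l (t, w))} \<le> card V"
    and \<phi>: "48 * card {(t, w). length t = 2 * K \<and> w \<in> {..<K} \<times> {K..<2*K} \<and> (t, w) \<notin> S \<and>
        t ! snd w \<noteq> (\<phi> (snd w) (take (snd w) t) \<le> l (t, w))} \<le> card V"
  shows "8 * card {(t, a, b). length t = 2 * K \<and> a < K \<and> b \<in> {K..<2*K} \<and>
        t ! a \<noteq> (\<theta> a (take a t) < \<phi> b (take b t))} \<le> card V"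
    (is "8 * card ?M \<le> _")
proof -
  define A where "A = {(t, w). length t = 2 * K \<and> w \<in> {..<K} \<times> {K..<2*K} \<and> (t, w) \<notin> S \<and>
        t ! fst w \<noteq> (\<theta> (fst w) (take (fst w) t) \<le> l (t, w))}"
  define B where "B = {(t, w). length t = 2 * K \<and> w \<in> {..<K} \<times> {K..<2*K} \<and> (t, w) \<notin> S \<and>
        t ! snd w \<noteq> (\<phi> (snd w) (take (snd w) t) \<le> l (t, w))}"
  define flip where "flip = (\<lambda>(t, a :: nat, b). (t[b := \<not> t ! b], a, b))"
  \<comment> \<open>Three exceptional sets, each at most 1/48 of \<open>V\<close>, together with
    their images under \<open>flip\<close>, account for at most 6/48 = 1/8 of
    \<open>V\<close>.\<close>
  define R where "R = S \<inter> V \<union> A \<union> B"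
  have "finite {t :: bool list. length t = 2 * K}"
    using finite_lists_length_eq[of "UNIV :: bool set" "2 * K"] by simp
  then have finV: "finite V"
    by (simp add: V)
  have "R \<subseteq> V"
    by (auto simp: R_def A_def B_def V)
  then have finR: "finite R"
    using finV by (rule finite_subset)
  have "card R \<le> card (S \<inter> V) + card A + card B"
    unfolding R_def using card_Un_le[of "S \<inter> V \<union> A" B] card_Un_le[of "S \<inter> V" A] by linarith
  then have R: "48 * card R \<le> 3 * card V"
    using S \<theta> \<phi> unfolding A_def B_def by linarith
  have "?M \<subseteq> R \<union> flip ` R"
  proof
    fix v assume "v \<in> ?M"
    then obtain t a b where v: "v = (t, a, b)" and t: "length t = 2 * K" and ab: "a < K" "K \<le> b" "b < 2 * K"
      and M: "t ! a \<noteq> (\<theta> a (take a t) < \<phi> b (take b t))"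
      by auto
    define t' where "t' = t[b := \<not> t ! b]"
    have t': "length t' = 2 * K" "t' ! a = t ! a" "t' ! b \<longleftrightarrow> \<not> t ! b" "take a t' = take a t" "take b t' = take b t"
      "t'[b := \<not> t' ! b] = t"
      using t ab by (auto simp: t'_def list_update_same_conv)
    have "v \<in> R \<or> flip v \<in> R"
    proof (rule ccontr)
      assume "\<not> (v \<in> R \<or> flip v \<in> R)"
      moreover have "flip v = (t', a, b)"
        by (simp add: flip_def v t'_def)
      ultimately have "(t, a, b) \<notin> R" "(t', a, b) \<notin> R"
        by (auto simp: v)
      then have "t ! a = (\<theta> a (take a t) \<le> l (t, a, b))" "t ! b = (\<phi> b (take b t) \<le> l (t, a, b))"
        "t ! a = (\<theta> a (take a t) \<le> l (t', a, b))" "(\<not> t ! b) = (\<phi> b (take b t) \<le> l (t', a, b))"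
        using t t' ab by (auto simp: R_def A_def B_def V)
      then show False
        using M by (cases "t ! a"; cases "t ! b") auto
    qed
    moreover have "flip (flip v) = v"
      using t' by (simp add: flip_def v t'_def)
    ultimately show "v \<in> R \<union> flip ` R"
      by (metis UnCI image_eqI)
  qed
  then have "card ?M \<le> card (R \<union> flip ` R)"
    using finR by (intro card_mono) auto
  also have "\<dots> \<le> card R + card R"
    using card_Un_le[of R "flip ` R"] card_image_le[OF finR, of flip] by linarith
  finally show ?thesis
    using R by linarith
qed

section \<open>Robust dags\<close>

lemma rtrancl_last_if_vwalk_arcs:
  assumes "set (vwalk_arcs p) \<subseteq> R" "x \<in> set p"
  shows "(x, last p) \<in> R\<^sup>*"
  using assms
proof (induction p arbitrary: x)
  case (Cons u p)
  show ?case
  proof (cases "p = []")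
    case False
    then have "(y, last p) \<in> R\<^sup>*" if "y \<in> set p" for y
      using Cons.prems(1) that by (intro Cons.IH) auto
    moreover have "(u, hd p) \<in> R"
      using Cons.prems(1) False by simp
    ultimately show ?thesis
      using Cons.prems(2) False by (auto intro: converse_rtrancl_into_rtrancl)
  qed (use Cons.prems(2) in simp)
qed simp

lemma dag_if_acyclic:
  assumes "finite (pverts G)" "pverts G \<noteq> {}" "parcs G \<subseteq> pverts G \<times> pverts G" "acyclic (parcs G)"
  shows "dag G"
proof -
  have "finite (parcs G)"
    using assms by (meson finite_SigmaI finite_subset)
  moreover have "(x, x) \<notin> parcs G" for x
    using assms(4) by (auto simp: acyclic_def)
  ultimately interpret pair_digraph G
    using assms by unfold_locales auto
  have "\<not> pre_digraph.cycle (with_proj G) p" for p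
  proof
    assume "pre_digraph.cycle (with_proj G) p"
    then obtain u where "awalk u p u" "p \<noteq> []"
      by (auto simp: cycle_def)
    then have "(u, u) \<in> (parcs G)\<^sup>+"
      using reachable1_awalk by blast
    then show False
      using assms by (auto simp: acyclic_def)
  qed
  then show ?thesis
    using assms(2) by (auto simp: dag_def)
qed

text \<open>The label of a vertex is the length of the longest path ending there.\<close>

lemma exists_path_labelling:
  assumes fin: "finite (pverts G)" and sub: "parcs G \<subseteq> pverts G \<times> pverts G"
    and acyc: "acyclic (parcs G)" and S: "S \<subset> pverts G"
  obtains l where "\<And>v. v \<in> pverts G - S \<Longrightarrow> l v \<le> codepth S G"
    and "\<And>u v. (u, v) \<in> parcs G \<Longrightarrow> u \<notin> S \<Longrightarrow> v \<notin> S \<Longrightarrow> l u < l v"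
proof -
  define Q where "Q v = {p. vpath p (with_proj G) \<and> set p \<inter> S = {} \<and> last p = v}" for v
  define l where "l v = Max (vwalk_length ` Q v)" for v
  have Q_le: "vwalk_length p \<le> codepth S G" if "p \<in> Q v" for p v
    using that le_codepth_iff[OF fin S] by (auto simp: Q_def)
  have finQ: "finite (vwalk_length ` Q v)" for v
    by (rule finite_subset[of _ "{..codepth S G}"]) (use Q_le in auto)
  have single: "[v] \<in> Q v" if "v \<in> pverts G - S" for v
    using that by (auto simp: Q_def vpath_def vwalk_def)
  show ?thesis
  proof
    fix v assume "v \<in> pverts G - S"
    then have "vwalk_length ` Q v \<noteq> {}"
      using single by blast
    then show "l v \<le> codepth S G"
      unfolding l_def using finQ Q_le by (subst Max_le_iff) auto
  next
    fix u v assume uv: "(u, v) \<in> parcs G" "u \<notin> S" "v \<notin> S"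
    then have "vwalk_length ` Q u \<noteq> {}"
      using single sub by blast
    then have "l u \<in> vwalk_length ` Q u"
      unfolding l_def using finQ by (intro Max_in)
    then obtain p where p: "p \<in> Q u" "l u = vwalk_length p"
      by auto
    then have vp: "p \<noteq> []" "distinct p" "set p \<subseteq> pverts G" "set (vwalk_arcs p) \<subseteq> parcs G" "last p = u"
      by (auto simp: Q_def vpath_def vwalk_def)
    \<comment> \<open>Otherwise the part of \<open>p\<close> from \<open>v\<close> to
      \<open>u\<close>, followed by the arc from \<open>u\<close> to \<open>v\<close>, would close a
      cycle.\<close>
    have "v \<notin> set p"
    proof
      assume "v \<in> set p"
      then have "(v, u) \<in> (parcs G)\<^sup>*"
        using rtrancl_last_if_vwalk_arcs[OF vp(4)] vp by blast
      then have "(v, v) \<in> (parcs G)\<^sup>+"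
        using uv(1) by (rule rtrancl_into_trancl1)
      then show False
        using acyc by (auto simp: acyclic_def)
    qed
    then have "p @ [v] \<in> Q v"
      using p(1) vp uv sub by (auto simp: Q_def vpath_def vwalk_def set_vwalk_arcs_snoc)
    then have "vwalk_length (p @ [v]) \<le> l v"
      unfolding l_def using finQ by (intro Max_ge imageI)
    then show "l u < l v"
      using p(2) vp(1) by (cases p) auto
  qed
qed

text \<open>\<open>881 / 500\<close> is \<open>(1 + w) / w powr (1/4)\<close> for \<open>w = (4/5) ^ 4\<close>: its \<open>K\<close>-th power bounds the number
  of bit strings of length \<open>K\<close> with at most \<open>K/4\<close> ones.\<close>

definition robust_dag :: "nat \<Rightarrow> nat \<Rightarrow> 'a pair_pre_digraph \<Rightarrow> bool" where
  "robust_dag d K G \<longleftrightarrow> dag G \<and> card (pverts G) = 4 ^ K * (K * K) \<and>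
    (\<forall>v. in_degree (with_proj G) v \<le> d \<and> out_degree (with_proj G) v \<le> d) \<and>
    (\<forall>S. S \<subset> pverts G \<longrightarrow> 48 * card S \<le> card (pverts G) \<longrightarrow>
      2 ^ K \<le> 2 * (real (codepth S G) + 2) * (881 / 500) ^ K)"

text \<open>Unites the digraphs testing positions \<open>a\<close> and \<open>b\<close>. Labels
  increase along the arcs of both, so each digraph yields thresholds for the same labelling, and
  comparing the two families of thresholds bounds the codepth from below.\<close>

lemma exists_robust_dag: "\<exists>d. \<forall>K>0. \<exists>G :: nat pair_pre_digraph. robust_dag d K G"
proof -
  obtain d :: nat where d: "\<forall>(W :: (nat \<times> nat) set) s n. finite W \<longrightarrow> (\<forall>w \<in> W. s w < n) \<longrightarrow>
      (\<exists>E. threshold_digraph d n W s E)"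
    using exists_threshold_digraph ..
  show ?thesis
  proof (intro exI[of _ "2 * d"] allI impI)
    fix K :: nat assume K: "0 < K"
    define W where "W = {..<K} \<times> {K..<2*K}"
    define V where "V = {t :: bool list. length t = 2 * K} \<times> W"
    have finV: "finite V" and cardV: "card V = 4 ^ K * (K * K)" and finW: "finite W" and cardW: "card W = K * K"
      using finite_lists_length_eq[of "UNIV :: bool set" "2 * K"]
        card_lists_length_eq[of "UNIV :: bool set" "2 * K"]
      by (auto simp: V_def W_def card_UNIV_bool power_mult card_cartesian_product)
    have "\<forall>w \<in> W. fst w < 2 * K" "\<forall>w \<in> W. snd w < 2 * K"
      by (auto simp: W_def)
    then obtain E1 E2 where threshold: "threshold_digraph d (2 * K) W fst E1"
      "threshold_digraph d (2 * K) W snd E2"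
      using d[rule_format, OF finW] by metis
    note E1 = threshold_digraphD[OF threshold(1), folded V_def]
      and E2 = threshold_digraphD[OF threshold(2), folded V_def]
    define E where "E = E1 \<union> E2"
    have E_V: "E \<subseteq> V \<times> V"
      using E1(1) E2(1) by (auto simp: E_def)
    have finE: "finite (E `` {v})" "finite (E\<inverse> `` {v})" for v
      by (rule finite_subset[OF _ finV], use E_V in blast)+
    have E_out: "card (E `` {v}) \<le> 2 * d" for v
      using card_Un_le[of "E1 `` {v}" "E2 `` {v}"] E1(2)[of v] E2(2)[of v] by (simp add: E_def Un_Image)
    have E_in: "card (E\<inverse> `` {v}) \<le> 2 * d" for v
      using card_Un_le[of "E1\<inverse> `` {v}" "E2\<inverse> `` {v}"] E1(3)[of v] E2(3)[of v]
      by (simp add: E_def Un_Image converse_Un)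
    \<comment> \<open>An injection into \<open>nat\<close> gives the graphs for all \<open>K\<close>
      a common, plain vertex type.\<close>
    define enc :: "bool list \<times> nat \<times> nat \<Rightarrow> nat" where "enc = to_nat"
    have enc: "enc u = enc v \<longleftrightarrow> u = v" for u v
      by (simp add: enc_def)
    define G where "G = \<lparr>pverts = enc ` V, parcs = map_prod enc enc ` E\<rparr>"
    have fin: "finite (pverts G)"
      using finV by (simp add: G_def)
    have cardG: "card (pverts G) = 4 ^ K * (K * K)"
      using cardV by (simp add: G_def card_image inj_on_def enc)
    have ne: "pverts G \<noteq> {}"
      using cardG K by fastforce
    have sub: "parcs G \<subseteq> pverts G \<times> pverts G"
      using E_V by (auto simp: G_def)
    \<comment> \<open>Arcs of both digraphs increase the string in one well-founded order, so no
      cycle can mix them.\<close>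
    have "wf (lex {(False, True)})"
      by (intro wf_lex wf_insert[THEN iffD2]) auto
    then have "wf (inv_image (lex {(False, True)}) (\<lambda>x. fst (from_nat x :: bool list \<times> nat \<times> nat)))"
      by (rule wf_inv_image)
    then have "wf (parcs G)"
      by (rule wf_subset) (use E1(4) E2(4) in \<open>auto simp: G_def E_def enc_def\<close>)
    then have acyc: "acyclic (parcs G)"
      by (rule wf_acyclic)
    have out: "out_degree (with_proj G) x \<le> 2 * d" for x
    proof -
      have "out_arcs (with_proj G) x \<subseteq> (\<lambda>v. (x, enc v)) ` (E `` {from_nat x})"
        by (auto simp: out_arcs_def G_def enc_def)
      then have "out_degree (with_proj G) x \<le> card (E `` {from_nat x})"
        unfolding out_degree_def by (rule surj_card_le[OF finE(1)])
      then show ?thesis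
        using E_out le_trans by blast
    qed
    have "in": "in_degree (with_proj G) x \<le> 2 * d" for x
    proof -
      have "in_arcs (with_proj G) x \<subseteq> (\<lambda>v. (enc v, x)) ` (E\<inverse> `` {from_nat x})"
        by (auto simp: in_arcs_def G_def enc_def)
      then have "in_degree (with_proj G) x \<le> card (E\<inverse> `` {from_nat x})"
        unfolding in_degree_def by (rule surj_card_le[OF finE(2)])
      then show ?thesis
        using E_in le_trans by blast
    qed
    have bound: "2 ^ K \<le> 2 * (real (codepth S G) + 2) * (881 / 500) ^ K"
      if S: "S \<subset> pverts G" and small: "48 * card S \<le> card (pverts G)" for S
    proof -
      obtain l where l: "\<And>v. v \<in> pverts G - S \<Longrightarrow> l v \<le> codepth S G"
        "\<And>u v. (u, v) \<in> parcs G \<Longrightarrow> u \<notin> S \<Longrightarrow> v \<notin> S \<Longrightarrow> l u < l v"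
        using exists_path_labelling[OF fin sub acyc S] by metis
      define T where "T = {v. enc v \<in> S}"
      have "enc ` (T \<inter> V) \<subseteq> S" 
        by (auto simp: T_def)
      then have "card (enc ` (T \<inter> V)) \<le> card S"
        using S fin by (intro card_mono) (auto dest: finite_subset)
      then have T: "48 * card (T \<inter> V) \<le> card V"
        using small by (simp add: card_image inj_on_def enc cardG cardV)
      have mono: "l (enc u) < l (enc v)" if "(u, v) \<in> E" "u \<notin> T" "v \<notin> T" for u v
        using that by (intro l(2)) (auto simp: G_def T_def)
      have le: "l (enc v) \<le> codepth S G" if "v \<in> V - T" for v
        using l(1) that by (auto simp: G_def T_def)
      have W_V: "2 ^ (2 * K) * card W = card V"
        by (simp add: cardV cardW power_mult)
      have "\<exists>\<theta>. (\<forall>j p. \<theta> j p \<le> Suc (codepth S G)) \<and>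
          48 * card {(t, w). length t = 2 * K \<and> w \<in> W \<and> (t, w) \<notin> T \<and>
            t ! fst w \<noteq> (\<theta> (fst w) (take (fst w) t) \<le> l (enc (t, w)))} \<le> card V"
        unfolding W_V[symmetric] by (rule E1(5)) (use mono le in \<open>auto simp: E_def\<close>)
      then obtain \<theta>' where \<theta>': "48 * card {(t, w). length t = 2 * K \<and> w \<in> W \<and> (t, w) \<notin> T \<and>
            t ! fst w \<noteq> (\<theta>' (fst w) (take (fst w) t) \<le> l (enc (t, w)))} \<le> card V"
        by blast
      have "\<exists>\<phi>. (\<forall>j p. \<phi> j p \<le> Suc (codepth S G)) \<and>
          48 * card {(t, w). length t = 2 * K \<and> w \<in> W \<and> (t, w) \<notin> T \<and>
            t ! snd w \<noteq> (\<phi> (snd w) (take (snd w) t) \<le> l (enc (t, w)))} \<le> card V"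
        unfolding W_V[symmetric] by (rule E2(5)) (use mono le in \<open>auto simp: E_def\<close>)
      then obtain \<phi>' where \<phi>': "\<And>j p. \<phi>' j p \<le> Suc (codepth S G)"
        "48 * card {(t, w). length t = 2 * K \<and> w \<in> W \<and> (t, w) \<notin> T \<and>
            t ! snd w \<noteq> (\<phi>' (snd w) (take (snd w) t) \<le> l (enc (t, w)))} \<le> card V"
        by blast
      have "8 * card {(t, a, b). length t = 2 * K \<and> a < K \<and> b \<in> {K..<2*K} \<and>
          t ! a \<noteq> (\<theta>' a (take a t) < \<phi>' b (take b t))} \<le> card V"
        by (rule card_threshold_comparison_errors[OF V_def[unfolded W_def] T
              \<theta>'[unfolded W_def] \<phi>'(2)[unfolded W_def]])
      \<comment> \<open>The thresholds are at most \<open>Suc (codepth S G)\<close>, hence take at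
        most \<open>codepth S G + 2\<close> values.\<close>
      then show ?thesis
        using threshold_count_bound[of K \<phi>' "Suc (codepth S G)" \<theta>'] K \<phi>'(1)
        by (simp add: cardV add.commute)
    qed
    have "robust_dag (2 * d) K G"
      unfolding robust_dag_def using dag_if_acyclic[OF fin ne sub acyc] cardG "in" out bound by simp
    then show "\<exists>G :: nat pair_pre_digraph. robust_dag (2 * d) K G" ..
  qed
qed

section \<open>The exponent and the extender sequence\<close>

theorem theorem5:
  shows "\<exists>\<delta>::real. 0.0185 \<le> \<delta> \<and> \<delta> < 0.0195 \<and>
    (\<exists>G :: nat \<Rightarrow> nat pair_pre_digraph.
       bounded_degrees G \<and> extender_sequence (\<lambda>n. real n powr \<delta>) G)"
proof -
  \<comment> \<open>The growth rates only require \<open>4 powr \<delta>\<close> to be below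
    \<open>2 / (881/500) = 1000/881\<close>. The crude bound \<open>11/10\<close> suffices, from
    \<open>4 \<le> (11/10) ^ 15\<close> and \<open>15 * 0.019 \<le> 1\<close>.\<close>
  define \<delta> :: real where "\<delta> = 0.019"
  define N :: "nat \<Rightarrow> nat" where "N K = 4 ^ K * (K * K)" for K
  have N_le: "real (N K) powr \<delta> \<le> (11/10) ^ K * real K ^ 2" for K
  proof -
    have "(4 :: real) powr \<delta> \<le> ((11/10) ^ 15) powr \<delta>"
      unfolding \<delta>_def by (intro powr_mono2) (auto simp: power_divide)
    also have "(11/10 :: real) ^ 15 = (11/10) powr 15"
      by simp
    also have "((11/10) powr 15) powr \<delta> = (11/10 :: real) powr (15 * \<delta>)"
      by (rule powr_powr)
    also have "\<dots> \<le> (11/10) powr 1"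
      unfolding \<delta>_def by (intro powr_mono) auto
    finally have "(4 :: real) powr \<delta> \<le> 11/10"
      by simp
    then have "(4 powr \<delta>) ^ K \<le> (11/10 :: real) ^ K"
      by (intro power_mono) auto
    moreover have "(4 ^ K) powr \<delta> = (4 powr \<delta> :: real) ^ K"
    proof -
      have "(4 ^ K) powr \<delta> = (4 powr real K :: real) powr \<delta>"
        by (subst powr_realpow) auto
      also have "\<dots> = (4 powr \<delta>) powr real K"
        unfolding powr_powr by (simp only: mult.commute)
      also have "\<dots> = (4 powr \<delta>) ^ K"
        by (rule powr_realpow) simp
      finally show ?thesis .
    qed
    moreover have "(real K ^ 2) powr \<delta> \<le> real K ^ 2"
    proof (cases "K = 0")
      case False
      then have "(real K ^ 2) powr \<delta> \<le> (real K ^ 2) powr 1"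
        unfolding \<delta>_def by (intro powr_mono) auto
      then show ?thesis by simp
    qed simp
    ultimately show ?thesis
      by (simp add: N_def powr_mult power2_eq_square mult_mono)
  qed
  \<comment> \<open>As \<open>11/10 < 1000/881\<close>, the exponential gap absorbs the factor
    \<open>K ^ 2\<close> and the constants.\<close>
  have "eventually (\<lambda>K. (11/10) ^ K * real K ^ 2 \<le> (2 / (881/500)) ^ K / 2 - 2) sequentially"
    by real_asymp
  then have "eventually (\<lambda>K. real (N K) powr \<delta> \<le> (2 / (881/500)) ^ K / 2 - 2) sequentially"
    by eventually_elim (rule order_trans[OF N_le])
  then obtain K0 where K0: "\<And>K. K \<ge> K0 \<Longrightarrow> real (N K) powr \<delta> \<le> (2 / (881/500)) ^ K / 2 - 2"
    by (auto simp: eventually_at_top_linorder)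
  \<comment> \<open>Starting beyond \<open>K0\<close> makes the codepth bound valid for every member
    of the sequence, and \<open>Suc\<close> keeps the parameter positive.\<close>
  define k where "k n = Suc (K0 + n)" for n
  have k_pos: "0 < k n" for n
    by (simp add: k_def)
  obtain d where d: "\<forall>K>0. \<exists>G :: nat pair_pre_digraph. robust_dag d K G"
    using exists_robust_dag ..
  then have "\<forall>n. \<exists>G :: nat pair_pre_digraph. robust_dag d (k n) G"
    using k_pos by blast
  from choice[OF this] obtain G :: "nat \<Rightarrow> nat pair_pre_digraph" where "\<forall>n. robust_dag d (k n) (G n)" ..
  note G = this[unfolded robust_dag_def, rule_format]
  have dag: "dag (G n)" and card: "card (pverts (G n)) = N (k n)"
    and deg: "in_degree (with_proj (G n)) v \<le> d" "out_degree (with_proj (G n)) v \<le> d"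
    and long: "S \<subset> pverts (G n) \<Longrightarrow> 48 * card S \<le> card (pverts (G n)) \<Longrightarrow>
      2 ^ k n \<le> 2 * (real (codepth S (G n)) + 2) * (881 / 500) ^ k n" for n v S
    using G[of n] by (auto simp: N_def)
  \<comment> \<open>The witnesses are \<open>\<epsilon> = 1/48\<close>, the density of deleted
    vertices that \<open>robust_dag\<close> tolerates, and \<open>C = 1\<close>, since the constants
    are already absorbed by \<open>K0\<close>.\<close>
  have ext: "extender (1/48) (1 * real (card (pverts (G n))) powr \<delta>) (G n)" for n
    unfolding extender_def
  proof (intro conjI allI impI dag)
    fix S assume S: "S \<subset> pverts (G n) \<and> real (card S) \<le> 1/48 * real (card (pverts (G n)))"
    then have "2 ^ k n \<le> 2 * (real (codepth S (G n)) + 2) * (881 / 500) ^ k n"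
      by (intro long) auto
    then have "(2 / (881/500)) ^ k n \<le> 2 * (real (codepth S (G n)) + 2)"
      unfolding power_divide by (subst pos_divide_le_eq) auto
    then show "1 * real (card (pverts (G n))) powr \<delta> \<le> real (codepth S (G n))"
      using K0[of "k n"] by (simp add: card k_def)
  qed
  have "n \<le> card (pverts (G n))" for n
  proof -
    have "n * 1 \<le> k n * (4 ^ k n * k n)"
      using k_pos[of n] by (intro mult_mono) (auto simp: k_def Suc_le_eq)
    then show ?thesis
      by (simp add: card N_def mult_ac)
  qed
  then have "filterlim (\<lambda>n. card (pverts (G n))) at_top sequentially"
    by (intro filterlim_at_top_mono[OF filterlim_ident]) auto
  moreover have "filterlim (\<lambda>n. real n powr \<delta>) at_top sequentially"
    unfolding \<delta>_def by real_asymp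
  moreover have "bounded_in_degrees G"
    unfolding bounded_in_degrees_def using deg by blast
  moreover have "\<exists>\<epsilon>>0. \<exists>C>0. \<forall>n. extender \<epsilon> (C * real (card (pverts (G n))) powr \<delta>) (G n)"
    using ext by (intro exI[of _ "1/48 :: real"] exI[of _ "1 :: real"] conjI allI) simp_all
  ultimately have "extender_sequence (\<lambda>n. real n powr \<delta>) G"
    unfolding extender_sequence_def using dag by auto
  moreover have "bounded_degrees G"
    unfolding bounded_degrees_def degree_at_def using deg add_mono by blast
  ultimately show ?thesis
    by (intro exI[of _ \<delta>]) (auto simp: \<delta>_def)
qed

end
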